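(* Let $\Bbbk$ be a field and let $\Gamma=(V,E)$ be a connected graph. If $\Gamma$ is not bipartite, then the zigzag algebra $A(\Gamma)$ is not isomorphic to $B^\Gamma_\Omega$ (as a graded $\Bbbk$-algebra) for any collection of orientation coefficients $\Omega$.
   Context: Graphs $\Gamma=(V,E)$ are finite, with no loops or multiple edges ($E$ is a set of two-element subsets of $V$). A graph is bipartite if $V$ is a disjoint union of two subsets such that each edge contains one element of each. A connected non-bipartite graph has at least three vertices. The double graph $D\Gamma$ is the quiver with vertex set $V$ and, for each $\{a,b\}\in E$, two directed edges $(a\,|\,b)$ (from $a$ to $b$) and $(b\,|\,a)$ (from $b$ to $a$). Paths in $D\Gamma$ are written $(a_1\,|\,\dots\,|\,a_n)$ (with $\{a_i,a_{i+1}\}\in E$), of length $n-1$. The path algebra $\Bbbk D\Gamma$ has the paths (including the length-zero path at each vertex) as basis and multiplication by concatenation (zero if the end of the first is not the start of the second), graded by path length. For $|V|\ge3$, the zigzag algebra $A(\Gamma)$ is the quotient of $\Bbbk D\Gamma$ by the two-sided ideal generated by all paths $(a_1\,|\,a_2\,|\,a_3)$ with $a_1\neq a_3$ and all elements $(a_1\,|\,a_2\,|\,a_1)-(a_1\,|\,a_3\,|\,a_1)$ with $a_1$ adjacent to both $a_2$ and $a_3$. A collection of orientation coefficients is a family $\Omega=(\epsilon_{a,b}\in\Bbbk : a,b\in V)$ such that $\epsilon_{a,b}=0$ if $\{a,b\}\notin E$, and $\epsilon_{a,b}\in\Bbbk^*=\Bbbk\setminus\{0\}$ with $\epsilon_{a,b}=-\epsilon_{b,a}$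 if $\{a,b\}\in E$. For $|V|\ge 3$, $B^\Gamma_\Omega$ is the quotient of $\Bbbk D\Gamma$ by the two-sided ideal generated by all paths $(a\,|\,b\,|\,c)$ with $\{a,b\},\{b,c\}\in E$, $a\ne c$, and all elements $\epsilon_{a,b}(a\,|\,b\,|\,a)-\epsilon_{a,c}(a\,|\,c\,|\,a)$ with $a$ adjacent to both $b$ and $c$. Both algebras are graded by path length.
   Formalization: The field is assumed to have characteristic different from 2; in characteristic 2 the claim is false, since taking all orientation coefficients equal to 1 on edges makes the two algebras coincide. *)

theory Defs
  imports "HOL-Algebra.QuotRing" "HOL-Algebra.Module"
begin

section \<open>Graphs\<close>

definition simple_graph :: "'v set \<Rightarrow> 'v set set \<Rightarrow> bool" where
  "simple_graph V E \<longleftrightarrow> finite V \<and> (\<forall>e\<in>E. e \<subseteq> V \<and> card e = 2)"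

definition bipartite :: "'v set \<Rightarrow> 'v set set \<Rightarrow> bool" where
  "bipartite V E \<longleftrightarrow>
     (\<exists>X Y. X \<union> Y = V \<and> X \<inter> Y = {} \<and> (\<forall>e\<in>E. \<exists>x\<in>X. \<exists>y\<in>Y. e = {x, y}))"

text \<open>The path \<open>(a\<^sub>1 | \<dots> | a\<^sub>n)\<close> of the double graph is the nonempty list \<open>[a\<^sub>1, \<dots>, a\<^sub>n]\<close>;
  its length as a path is one less than its length as a list.\<close>

definition paths :: "'v set \<Rightarrow> 'v set set \<Rightarrow> 'v list set" where
  "paths V E = {p. p \<noteq> [] \<and> set p \<subseteq> V \<and> successively (\<lambda>a b. {a, b} \<in> E) p}"

definition connected_graph :: "'v set \<Rightarrow> 'v set set \<Rightarrow> bool" where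
  "connected_graph V E \<longleftrightarrow> (\<forall>a\<in>V. \<forall>b\<in>V. \<exists>p\<in>paths V E. hd p = a \<and> last p = b)"

section \<open>Graded algebras\<close>

text \<open>The scalars form a type of class \<open>field\<close>; an algebra is a (possibly noncommutative)
  ring record with a scalar multiplication and its homogeneous components.\<close>

record ('k, 'a) graded_algebra = "('k, 'a) module" +
  grade :: "nat \<Rightarrow> 'a set"

text \<open>The scalar multiple of a coset \<open>I + x\<close> is the coset \<open>I + c x\<close>, written
  without a choice of representative.\<close>

definition graded_quotient ::
    "('k, 'a) graded_algebra \<Rightarrow> 'a set \<Rightarrow> ('k, 'a set) graded_algebra" where
  "graded_quotient A I =
     \<lparr>carrier = carrier (A Quot I), mult = mult (A Quot I), one = one (A Quot I),
      zero = zero (A Quot I), add = add (A Quot I),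
      smult = (\<lambda>c X. \<Union>x\<in>X. I +>\<^bsub>A\<^esub> (c \<odot>\<^bsub>A\<^esub> x)),
      grade = (\<lambda>n. (\<lambda>x. I +>\<^bsub>A\<^esub> x) ` grade A n)\<rparr>"

definition graded_algebra_iso ::
    "('k, 'a) graded_algebra \<Rightarrow> ('k, 'b) graded_algebra \<Rightarrow> ('a \<Rightarrow> 'b) set" where
  "graded_algebra_iso A B =
     {h \<in> ring_iso A B.
        (\<forall>c. \<forall>x\<in>carrier A. h (c \<odot>\<^bsub>A\<^esub> x) = c \<odot>\<^bsub>B\<^esub> h x) \<and>
        (\<forall>n. h ` grade A n = grade B n)}"

definition isomorphic_graded_algebras ::
    "('k, 'a) graded_algebra \<Rightarrow> ('k, 'b) graded_algebra \<Rightarrow> bool" where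
  "isomorphic_graded_algebras A B \<longleftrightarrow> graded_algebra_iso A B \<noteq> {}"

section \<open>The path algebra of the double graph\<close>

text \<open>Elements are the finitely supported coefficient functions on paths. The product
  is the bilinear extension of concatenation, \<open>(a | \<dots> | b) (b | \<dots> | c) = (a | \<dots> | b | \<dots> | c)\<close>;
  the sum below is finite because \<open>p\<close> has only finitely many decompositions.\<close>

definition path_algebra ::
    "'v set \<Rightarrow> 'v set set \<Rightarrow> ('k::field, 'v list \<Rightarrow> 'k) graded_algebra" where
  "path_algebra V E =
     \<lparr>carrier = {f. finite {p. f p \<noteq> 0} \<and> {p. f p \<noteq> 0} \<subseteq> paths V E},
      mult = (\<lambda>f g p. \<Sum>(q, r) \<in> {(q, r). q \<in> paths V E \<and> r \<in> paths V E \<and>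
                                        last q = hd r \<and> q @ tl r = p}. f q * g r),
      one = (\<lambda>p. if \<exists>a\<in>V. p = [a] then 1 else 0),
      zero = (\<lambda>p. 0),
      add = (\<lambda>f g p. f p + g p),
      smult = (\<lambda>c f p. c * f p),
      grade = (\<lambda>n. {f. finite {p. f p \<noteq> 0} \<and>
                       {p. f p \<noteq> 0} \<subseteq> {p \<in> paths V E. length p = n + 1}})\<rparr>"

definition basis_path :: "'v list \<Rightarrow> 'v list \<Rightarrow> 'k::field" where
  "basis_path p = (\<lambda>q. if q = p then 1 else 0)"

section \<open>Zigzag and skew-zigzag algebras\<close>

text \<open>The presentations below define these algebras for graphs with at least three vertices.\<close>

definition zigzag_relations :: "'v set set \<Rightarrow> ('v list \<Rightarrow> 'k::field) set" where
  "zigzag_relations E =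
     {basis_path [a, b, c] | a b c. {a, b} \<in> E \<and> {b, c} \<in> E \<and> a \<noteq> c} \<union>
     {(\<lambda>p. basis_path [a, b, a] p - basis_path [a, c, a] p) | a b c. {a, b} \<in> E \<and> {a, c} \<in> E}"

definition zigzag_algebra ::
    "'v set \<Rightarrow> 'v set set \<Rightarrow> ('k::field, ('v list \<Rightarrow> 'k) set) graded_algebra" where
  "zigzag_algebra V E =
     graded_quotient (path_algebra V E) (genideal (path_algebra V E) (zigzag_relations E))"

definition orientation_coefficients ::
    "'v set \<Rightarrow> 'v set set \<Rightarrow> ('v \<Rightarrow> 'v \<Rightarrow> 'k::field) \<Rightarrow> bool" where
  "orientation_coefficients V E \<epsilon> \<longleftrightarrow>
     (\<forall>a\<in>V. \<forall>b\<in>V. ({a, b} \<notin> E \<longrightarrow> \<epsilon> a b = 0) \<and>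
                   ({a, b} \<in> E \<longrightarrow> \<epsilon> a b \<noteq> 0 \<and> \<epsilon> a b = - \<epsilon> b a))"

definition skew_zigzag_relations ::
    "'v set set \<Rightarrow> ('v \<Rightarrow> 'v \<Rightarrow> 'k) \<Rightarrow> ('v list \<Rightarrow> 'k::field) set" where
  "skew_zigzag_relations E \<epsilon> =
     {basis_path [a, b, c] | a b c. {a, b} \<in> E \<and> {b, c} \<in> E \<and> a \<noteq> c} \<union>
     {(\<lambda>p. \<epsilon> a b * basis_path [a, b, a] p - \<epsilon> a c * basis_path [a, c, a] p) | a b c.
        {a, b} \<in> E \<and> {a, c} \<in> E}"

definition skew_zigzag_algebra ::
    "'v set \<Rightarrow> 'v set set \<Rightarrow> ('v \<Rightarrow> 'v \<Rightarrow> 'k::field) \<Rightarrow>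
       ('k, ('v list \<Rightarrow> 'k) set) graded_algebra" where
  "skew_zigzag_algebra V E \<epsilon> =
     graded_quotient (path_algebra V E) (genideal (path_algebra V E) (skew_zigzag_relations E \<epsilon>))"

end

theory Submission
  imports Defs
begin

text \<open>The two algebras are separated by their trace forms. Call a functional \<open>\<tau>\<close> symmetric if
  \<open>\<tau> (x y) = \<tau> (y x)\<close> for all \<open>x\<close>, \<open>y\<close> of degree one. A graded
  isomorphism transports symmetric functionals together with the values that they take in each
  degree (\<open>isomorphic_quotients_symmetric_trace\<close>). It thus suffices that one algebra has a symmetric
  functional that is nonzero in degree two, and the other has none.

  On the zigzag algebra, the functional that sends each closed path \<open>(a | b | a)\<close> to one
  and all other paths to zero is well defined, because the relations identify all these paths at a given vertex, and it is symmetric,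
  because exchanging the factors of \<open>(a | b) (b | a)\<close> gives \<open>(b | a | b)\<close>
  (\<open>loop_trace_symmetric\<close>).

  On the algebra with orientation coefficients, let \<open>\<phi>\<close> be symmetric and fix a scalar \<open>c\<close>. By the
  relations, \<open>s a = \<phi> (c \<epsilon>\<^sub>a\<^sub>b (a | b | a))\<close> is the same for all neighbours \<open>b\<close> of \<open>a\<close>. Symmetry of
  \<open>\<phi>\<close> and antisymmetry of \<open>\<epsilon>\<close> give \<open>s b = - s a\<close> along each edge. If some value of \<open>s\<close> were nonzero,
  then by connectedness \<open>s\<close> would take only two values, opposite and distinct because the characteristic is
  not two, and its level sets would be a bipartition (\<open>sign_alternating_bipartite\<close>). Hence
  \<open>s = 0\<close>, and as the remaining paths of length two are relations, \<open>\<phi>\<close> vanishes in degree two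
  (\<open>symmetric_trace_skew_zero\<close>).\<close>

section \<open>The path algebra as a ring\<close>

lemma path_algebra_carrier:
  "f \<in> carrier (path_algebra V E) \<longleftrightarrow> finite {p. f p \<noteq> 0} \<and> {p. f p \<noteq> 0} \<subseteq> paths V E"
  by (simp add: path_algebra_def)

lemma path_algebra_grade:
  "f \<in> grade (path_algebra V E) n \<longleftrightarrow>
     f \<in> carrier (path_algebra V E) \<and> (\<forall>p. f p \<noteq> 0 \<longrightarrow> length p = n + 1)"
  by (auto simp: path_algebra_def)

lemma path_algebra_add [simp]: "(f \<oplus>\<^bsub>path_algebra V E\<^esub> g) p = f p + g p"
  by (simp add: path_algebra_def)

lemma path_algebra_zero [simp]: "\<zero>\<^bsub>path_algebra V E\<^esub> p = 0"
  by (simp add: path_algebra_def)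

lemma path_algebra_one: "\<one>\<^bsub>path_algebra V E\<^esub> p = (if \<exists>a\<in>V. p = [a] then 1 else 0)"
  by (simp add: path_algebra_def)

lemma path_concat:
  assumes "q \<in> paths V E" "r \<in> paths V E" "last q = hd r"
  shows "q @ tl r \<in> paths V E"
proof -
  obtain b r' where r: "r = b # r'" using assms(2) by (cases r) (auto simp: paths_def)
  show ?thesis using assms unfolding r
    by (cases r') (auto simp: paths_def successively_append_iff)
qed

definition decompositions where
  "decompositions V E p = {(q, r). q \<in> paths V E \<and> r \<in> paths V E \<and> last q = hd r \<and> q @ tl r = p}"

lemma path_algebra_mult:
  "(f \<otimes>\<^bsub>path_algebra V E\<^esub> g) p = (\<Sum>(q, r)\<in>decompositions V E p. f q * g r)"
  by (simp add: path_algebra_def decompositions_def)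

lemma decompositions_eq:
  "decompositions V E p =
     (\<lambda>i. (take (Suc i) p, drop i p)) `
       {i. i < length p \<and> take (Suc i) p \<in> paths V E \<and> drop i p \<in> paths V E}"
proof (intro Set.set_eqI iffI)
  fix x assume "x \<in> decompositions V E p"
  then obtain q r where x: "x = (q, r)" and qr: "q \<in> paths V E" "r \<in> paths V E"
    "last q = hd r" "q @ tl r = p"
    by (auto simp: decompositions_def)
  have ne: "q \<noteq> []" "r \<noteq> []" using qr by (auto simp: paths_def)
  then obtain q' where q': "q = q' @ [hd r]" using qr(3) by (metis append_butlast_last_id)
  let ?i = "length q'"
  have "p = q' @ hd r # tl r" using q' qr(4) by simp
  hence "take (Suc ?i) p = q" "drop ?i p = r" "?i < length p"
    using q' ne by (auto simp: take_Suc)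
  thus "x \<in> (\<lambda>i. (take (Suc i) p, drop i p)) `
       {i. i < length p \<and> take (Suc i) p \<in> paths V E \<and> drop i p \<in> paths V E}"
    using qr x by (intro image_eqI[of _ _ ?i]) auto
next
  fix x assume "x \<in> (\<lambda>i. (take (Suc i) p, drop i p)) `
       {i. i < length p \<and> take (Suc i) p \<in> paths V E \<and> drop i p \<in> paths V E}"
  then obtain i where i: "i < length p" "take (Suc i) p \<in> paths V E" "drop i p \<in> paths V E"
    "x = (take (Suc i) p, drop i p)" by auto
  moreover have "last (take (Suc i) p) = hd (drop i p)"
    using i(1) by (simp add: take_Suc_conv_app_nth hd_drop_conv_nth)
  moreover have "take (Suc i) p @ tl (drop i p) = p"
    by (simp add: drop_Suc tl_drop flip: drop_Suc)
  ultimately show "x \<in> decompositions V E p" by (auto simp: decompositions_def)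
qed

lemma finite_decompositions: "finite (decompositions V E p)"
  unfolding decompositions_eq by auto

text \<open>A path with \<open>n\<close> vertices has exactly one decomposition for each of its vertices, at which it is
  cut; the summands for the other pairs of lists vanish by the support condition. This replaces the
  sum over decompositions by one over an interval of indices, so that associativity is an exchange of
  two finite sums and the product can be evaluated on short paths by simplification.\<close>

lemma path_algebra_mult_splits:
  assumes "f \<in> carrier (path_algebra V E)" "g \<in> carrier (path_algebra V E)"
  shows "(f \<otimes>\<^bsub>path_algebra V E\<^esub> g) p = (\<Sum>i<length p. f (take (Suc i) p) * g (drop i p))"
proof -
  let ?J = "{i. i < length p \<and> take (Suc i) p \<in> paths V E \<and> drop i p \<in> paths V E}"
  have inj: "inj_on (\<lambda>i. (take (Suc i) p, drop i p)) ?J"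
  proof (rule inj_onI)
    fix i j assume "i \<in> ?J" "j \<in> ?J" "(take (Suc i) p, drop i p) = (take (Suc j) p, drop j p)"
    hence "length (drop i p) = length (drop j p)" "i < length p" "j < length p" by auto
    thus "i = j" by auto
  qed
  have "(f \<otimes>\<^bsub>path_algebra V E\<^esub> g) p = (\<Sum>i\<in>?J. f (take (Suc i) p) * g (drop i p))"
    unfolding path_algebra_mult decompositions_eq
    by (subst sum.reindex[OF inj]) simp
  also have "\<dots> = (\<Sum>i<length p. f (take (Suc i) p) * g (drop i p))"
    using assms by (intro sum.mono_neutral_left) (auto simp: path_algebra_carrier)
  finally show ?thesis .
qed

lemma path_algebra_mult_closed:
  assumes "f \<in> carrier (path_algebra V E)" "g \<in> carrier (path_algebra V E)"
  shows "f \<otimes>\<^bsub>path_algebra V E\<^esub> g \<in> carrier (path_algebra V E)"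
proof -
  let ?h = "f \<otimes>\<^bsub>path_algebra V E\<^esub> g"
  let ?S = "{p. f p \<noteq> 0} \<times> {p. g p \<noteq> 0}"
  have *: "\<exists>(q, r)\<in>decompositions V E p. f q * g r \<noteq> 0" if "?h p \<noteq> 0" for p
    using that unfolding path_algebra_mult by (smt (verit) case_prod_unfold sum.neutral)
  have "{p. ?h p \<noteq> 0} \<subseteq> (\<lambda>(q, r). q @ tl r) ` ?S"
    using * by (fastforce simp: decompositions_def)
  moreover have "finite ?S" using assms by (simp add: path_algebra_carrier)
  ultimately have "finite {p. ?h p \<noteq> 0}" by (meson finite_imageI finite_subset)
  moreover have "{p. ?h p \<noteq> 0} \<subseteq> paths V E"
    using * by (fastforce simp: decompositions_def intro: path_concat)
  ultimately show ?thesis by (simp add: path_algebra_carrier)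
qed

lemma path_algebra_assoc:
  assumes "f \<in> carrier (path_algebra V E)" "g \<in> carrier (path_algebra V E)"
    "h \<in> carrier (path_algebra V E)"
  shows "(f \<otimes>\<^bsub>path_algebra V E\<^esub> g) \<otimes>\<^bsub>path_algebra V E\<^esub> h =
         f \<otimes>\<^bsub>path_algebra V E\<^esub> (g \<otimes>\<^bsub>path_algebra V E\<^esub> h)"
proof
  fix p :: "'a list"
  let ?n = "length p"
  let ?t = "\<lambda>i j. f (take (Suc j) p) * g (drop j (take (Suc i) p)) * h (drop i p)"
  have "((f \<otimes>\<^bsub>path_algebra V E\<^esub> g) \<otimes>\<^bsub>path_algebra V E\<^esub> h) p =
        (\<Sum>i<?n. \<Sum>j<Suc i. ?t i j)"
    using assms
    by (auto simp: path_algebra_mult_splits path_algebra_mult_closed sum_distrib_right min_absorb2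
             simp del: sum.lessThan_Suc intro!: sum.cong)
  also have "\<dots> = (\<Sum>(i, j)\<in>(SIGMA i:{..<?n}. {..<Suc i}). ?t i j)"
    by (subst sum.Sigma) auto
  also have "\<dots> = (\<Sum>(j, k)\<in>(SIGMA j:{..<?n}. {..<?n - j}). ?t (j + k) j)"
    \<comment> \<open>The first cut is at vertex \<open>j\<close>, the second at vertex \<open>i = j + k\<close>.\<close>
    by (rule sum.reindex_bij_witness[of _ "\<lambda>(j, k). (j + k, j)" "\<lambda>(i, j). (j, i - j)"]) auto
  also have "\<dots> = (\<Sum>j<?n. \<Sum>k<?n - j. ?t (j + k) j)"
    by (subst sum.Sigma) auto
  also have "\<dots> = (f \<otimes>\<^bsub>path_algebra V E\<^esub> (g \<otimes>\<^bsub>path_algebra V E\<^esub> h)) p"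
    using assms
    by (auto simp: path_algebra_mult_splits path_algebra_mult_closed sum_distrib_left drop_take
                   add.commute mult.assoc intro!: sum.cong)
  finally show "((f \<otimes>\<^bsub>path_algebra V E\<^esub> g) \<otimes>\<^bsub>path_algebra V E\<^esub> h) p =
      (f \<otimes>\<^bsub>path_algebra V E\<^esub> (g \<otimes>\<^bsub>path_algebra V E\<^esub> h)) p" .
qed

lemma path_algebra_add_closed:
  assumes "f \<in> carrier (path_algebra V E)" "g \<in> carrier (path_algebra V E)"
  shows "f \<oplus>\<^bsub>path_algebra V E\<^esub> g \<in> carrier (path_algebra V E)"
proof -
  have "{p. f p + g p \<noteq> 0} \<subseteq> {p. f p \<noteq> 0} \<union> {p. g p \<noteq> 0}" by auto
  with assms show ?thesis
    by (auto simp: path_algebra_carrier intro: finite_subset)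
qed

lemma path_algebra_one_closed:
  assumes "finite V"
  shows "\<one>\<^bsub>path_algebra V E\<^esub> \<in> carrier (path_algebra V E)"
proof -
  have "{p. \<one>\<^bsub>path_algebra V E\<^esub> p \<noteq> (0::'b)} = (\<lambda>a. [a]) ` V"
    by (auto simp: path_algebra_one)
  with assms show ?thesis by (auto simp: path_algebra_carrier paths_def)
qed

lemma path_algebra_one_left:
  assumes "finite V" "f \<in> carrier (path_algebra V E)"
  shows "\<one>\<^bsub>path_algebra V E\<^esub> \<otimes>\<^bsub>path_algebra V E\<^esub> f = f"
proof
  fix p :: "'a list"
  show "(\<one>\<^bsub>path_algebra V E\<^esub> \<otimes>\<^bsub>path_algebra V E\<^esub> f) p = f p"
  proof (cases p)
    case Nil
    moreover have "f [] = 0" using assms(2) by (auto simp: path_algebra_carrier paths_def)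
    ultimately show ?thesis
      by (simp add: assms path_algebra_mult_splits path_algebra_one_closed)
  next
    case (Cons a q)
    have "a \<in> V \<or> f (a # q) = 0"
      using assms(2) by (auto simp: path_algebra_carrier paths_def)
    moreover have "(\<Sum>i<length q. (if a \<in> V \<and> take (Suc i) q = [] then 1 else 0) * f (drop i q)) = 0"
      by (intro sum.neutral) auto
    ultimately show ?thesis using assms
      by (auto simp: path_algebra_mult_splits path_algebra_one_closed Cons path_algebra_one
                     sum.lessThan_Suc_shift simp del: sum.lessThan_Suc)
  qed
qed

lemma path_algebra_one_right:
  assumes "finite V" "f \<in> carrier (path_algebra V E)"
  shows "f \<otimes>\<^bsub>path_algebra V E\<^esub> \<one>\<^bsub>path_algebra V E\<^esub> = f"
proof
  fix p :: "'a list"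
  show "(f \<otimes>\<^bsub>path_algebra V E\<^esub> \<one>\<^bsub>path_algebra V E\<^esub>) p = f p"
  proof (cases p rule: rev_cases)
    case Nil
    moreover have "f [] = 0" using assms(2) by (auto simp: path_algebra_carrier paths_def)
    ultimately show ?thesis
      by (simp add: assms path_algebra_mult_splits path_algebra_one_closed)
  next
    case (snoc q a)
    have "a \<in> V" if "f (q @ [a]) \<noteq> 0"
      using that assms(2) by (auto simp: path_algebra_carrier paths_def)
    then show ?thesis using assms
      by (auto simp: path_algebra_mult_splits path_algebra_one_closed snoc path_algebra_one
                     Cons_eq_append_conv append_eq_Cons_conv intro!: sum.neutral)
  qed
qed

lemma path_algebra_neg_closed:
  "f \<in> carrier (path_algebra V E) \<Longrightarrow> (\<lambda>p. - f p) \<in> carrier (path_algebra V E)"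
  by (simp add: path_algebra_carrier)

lemma ring_path_algebra:
  assumes "finite V"
  shows "ring (path_algebra V E :: ('k::field, 'v list \<Rightarrow> 'k) graded_algebra)"
    (is "ring ?P")
proof (rule ringI)
  show "abelian_group ?P"
  proof (rule abelian_groupI)
    show "\<exists>g\<in>carrier ?P. g \<oplus>\<^bsub>?P\<^esub> f = \<zero>\<^bsub>?P\<^esub>" if "f \<in> carrier ?P" for f
      using that by (intro bexI[of _ "\<lambda>p. - f p"]) (auto intro: path_algebra_neg_closed)
    show "\<zero>\<^bsub>?P\<^esub> \<in> carrier ?P" by (simp add: path_algebra_carrier)
  qed (auto intro: path_algebra_add_closed)
  show "Group.monoid ?P"
    by (rule monoidI)
      (auto simp: assms path_algebra_mult_closed path_algebra_one_closed path_algebra_assoc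
                  path_algebra_one_left path_algebra_one_right)
qed (auto simp: path_algebra_mult_splits path_algebra_add_closed algebra_simps sum.distrib)

section \<open>Homogeneous elements as sums of paths\<close>

definition monomial :: "'k::field \<Rightarrow> 'v list \<Rightarrow> 'v list \<Rightarrow> 'k" where
  "monomial c p = (\<lambda>q. if q = p then c else 0)"

lemma monomial_closed: "p \<in> paths V E \<Longrightarrow> monomial c p \<in> carrier (path_algebra V E)"
  by (auto simp: path_algebra_carrier monomial_def)

lemma monomial_grade:
  "p \<in> paths V E \<Longrightarrow> length p = n + 1 \<Longrightarrow> monomial c p \<in> grade (path_algebra V E) n"
  by (auto simp: path_algebra_grade monomial_closed) (auto simp: monomial_def split: if_splits)

lemma monomial_mult:
  assumes "q \<in> paths V E" "r \<in> paths V E" "last q = hd r"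
  shows "monomial c q \<otimes>\<^bsub>path_algebra V E\<^esub> monomial d r = monomial (c * d) (q @ tl r)"
proof
  fix p
  have "(monomial c q \<otimes>\<^bsub>path_algebra V E\<^esub> monomial d r) p =
        (\<Sum>x\<in>decompositions V E p. if x = (q, r) then c * d else 0)"
    unfolding path_algebra_mult by (intro sum.cong) (auto simp: monomial_def split: if_splits)
  also have "\<dots> = monomial (c * d) (q @ tl r) p"
    using assms by (simp add: finite_decompositions) (auto simp: decompositions_def monomial_def)
  finally show "(monomial c q \<otimes>\<^bsub>path_algebra V E\<^esub> monomial d r) p = monomial (c * d) (q @ tl r) p" .
qed

lemma grade_induct [consumes 1, case_names zero plus]:
  fixes f :: "'v list \<Rightarrow> 'k::field"
  assumes f: "f \<in> grade (path_algebra V E) n"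
    and zero: "Q \<zero>\<^bsub>path_algebra V E\<^esub>"
    and plus: "\<And>c p f. p \<in> paths V E \<Longrightarrow> length p = n + 1 \<Longrightarrow> f \<in> grade (path_algebra V E) n \<Longrightarrow>
                Q f \<Longrightarrow> Q (monomial c p \<oplus>\<^bsub>path_algebra V E\<^esub> f)"
  shows "Q f"
proof -
  have "Q f" if "finite S" "{p. f p \<noteq> 0} = S" "f \<in> grade (path_algebra V E) n" for S f
    using that
  proof (induction S arbitrary: f rule: finite_induct)
    case empty
    hence "f = \<zero>\<^bsub>path_algebra V E\<^esub>" by auto
    with zero show ?case by (simp only:)
  next
    case (insert p S)
    let ?g = "f(p := 0)"
    have S: "{q. ?g q \<noteq> 0} = S" using insert by auto
    have g: "?g \<in> grade (path_algebra V E) n"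
      using insert S by (auto simp: path_algebra_grade path_algebra_carrier)
    have p: "p \<in> paths V E" "length p = n + 1"
      using insert by (auto simp: path_algebra_grade path_algebra_carrier)
    have "f = monomial (f p) p \<oplus>\<^bsub>path_algebra V E\<^esub> ?g"
      by (auto simp: monomial_def)
    with plus[OF p g insert.IH[OF S g]] show ?case by metis
  qed
  with f show ?thesis by (auto simp: path_algebra_grade path_algebra_carrier)
qed

section \<open>Edges and relations\<close>

lemma edge_paths:
  assumes "simple_graph V E" "{a, b} \<in> E"
  shows "a \<in> V" "b \<in> V" "a \<noteq> b" "[a, b] \<in> paths V E" "[b, a] \<in> paths V E"
    "[a, b, a] \<in> paths V E"
proof -
  have "{a, b} \<subseteq> V" "card {a, b} = 2" using assms by (auto simp: simple_graph_def)
  thus "a \<in> V" "b \<in> V" "a \<noteq> b" "[a, b] \<in> paths V E" "[b, a] \<in> paths V E"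
    "[a, b, a] \<in> paths V E"
    using assms(2) by (auto simp: paths_def insert_commute)
qed

lemma two_edge_path:
  assumes "simple_graph V E" "{a, b} \<in> E" "{b, c} \<in> E"
  shows "[a, b, c] \<in> paths V E"
  using edge_paths[OF assms(1,2)] edge_paths[OF assms(1,3)] assms(2,3) by (auto simp: paths_def)

lemma basis_path_closed: "p \<in> paths V E \<Longrightarrow> basis_path p \<in> carrier (path_algebra V E)"
  by (auto simp: path_algebra_carrier basis_path_def)

lemma combination_closed:
  assumes "p \<in> paths V E" "q \<in> paths V E"
  shows "(\<lambda>r. c * basis_path p r - d * basis_path q r) \<in> carrier (path_algebra V E)"
proof -
  have "{r. c * basis_path p r - d * basis_path q r \<noteq> 0} \<subseteq> {p, q}"
    by (auto simp: basis_path_def)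
  thus ?thesis using assms finite_subset by (fastforce simp: path_algebra_carrier)
qed

lemma zigzag_relations_closed:
  assumes "simple_graph V E"
  shows "zigzag_relations E \<subseteq> carrier (path_algebra V E)"
  using combination_closed[where c=1 and d=1 and ?'a='a and V=V and E=E and ?'b='b]
  by (auto simp: zigzag_relations_def edge_paths[OF assms] two_edge_path[OF assms] basis_path_closed)

lemma skew_zigzag_relations_closed:
  assumes "simple_graph V E"
  shows "skew_zigzag_relations E \<epsilon> \<subseteq> carrier (path_algebra V E)"
  by (auto simp: skew_zigzag_relations_def edge_paths[OF assms] two_edge_path[OF assms]
                 combination_closed basis_path_closed)

section \<open>Symmetric traces and graded isomorphisms\<close>

text \<open>Functionals on a quotient \<open>P / I\<close> are represented by functionals on \<open>P\<close> that vanish on \<open>I\<close>,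
  so that functionals on different quotients of the same algebra can be compared.\<close>

definition symmetric_trace ::
    "('k, 'a, 'm) graded_algebra_scheme \<Rightarrow> 'a set \<Rightarrow> ('a \<Rightarrow> 'c::ab_group_add) \<Rightarrow> bool" where
  "symmetric_trace P I \<tau> \<longleftrightarrow>
     (\<forall>f\<in>carrier P. \<forall>g\<in>carrier P. \<tau> (f \<oplus>\<^bsub>P\<^esub> g) = \<tau> f + \<tau> g) \<and>
     (\<forall>f\<in>I. \<tau> f = 0) \<and>
     (\<forall>f\<in>grade P 1. \<forall>g\<in>grade P 1. \<tau> (f \<otimes>\<^bsub>P\<^esub> g) = \<tau> (g \<otimes>\<^bsub>P\<^esub> f))"

lemma symmetric_trace_cong:
  assumes "ideal I P" "symmetric_trace P I \<tau>" "x \<in> carrier P" "y \<in> carrier P"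
    "I +>\<^bsub>P\<^esub> x = I +>\<^bsub>P\<^esub> y"
  shows "\<tau> x = \<tau> y"
proof -
  interpret ideal I P by fact
  have d: "x \<ominus>\<^bsub>P\<^esub> y \<in> I"
    using quotient_eq_iff_same_a_r_cos[OF assms(1,3,4)] assms(5) by simp
  have "(x \<ominus>\<^bsub>P\<^esub> y) \<oplus>\<^bsub>P\<^esub> y = x" using assms(3,4)
    by (simp add: a_minus_def a_assoc l_neg)
  moreover have "\<tau> ((x \<ominus>\<^bsub>P\<^esub> y) \<oplus>\<^bsub>P\<^esub> y) = \<tau> (x \<ominus>\<^bsub>P\<^esub> y) + \<tau> y"
    using assms(2,4) a_Hcarr[OF d] unfolding symmetric_trace_def by blast
  moreover have "\<tau> (x \<ominus>\<^bsub>P\<^esub> y) = 0"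
    using assms(2) d unfolding symmetric_trace_def by blast
  ultimately show ?thesis by simp
qed

text \<open>The new functional is \<open>\<tau>\<close> composed with the inverse isomorphism. Because both are given on
  representatives, its value at \<open>f\<close> is the value of \<open>\<tau>\<close> at any \<open>x\<close> whose class is mapped to the class
  of \<open>f\<close>; the choice of \<open>x\<close> is immaterial as \<open>\<tau>\<close> is constant on cosets.\<close>

lemma isomorphic_quotients_symmetric_trace:
  fixes P :: "('k, 'a) graded_algebra"
  assumes I: "ideal I P" and J: "ideal J P"
    and grade: "\<And>n. grade P n \<subseteq> carrier P"
    and iso: "isomorphic_graded_algebras (graded_quotient P I) (graded_quotient P J)"
    and \<tau>: "symmetric_trace P I \<tau>"
  obtains \<phi> where "symmetric_trace P J \<phi>" "\<And>n. \<phi> ` grade P n = \<tau> ` grade P n"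
proof -
  interpret I: ideal I P by fact
  interpret J: ideal J P by fact
  let ?A = "graded_quotient P I" and ?B = "graded_quotient P J"
  obtain h where h: "h \<in> ring_hom ?A ?B" "bij_betw h (carrier ?A) (carrier ?B)"
    "\<And>n. h ` grade ?A n = grade ?B n"
    using iso by (auto simp: isomorphic_graded_algebras_def graded_algebra_iso_def ring_iso_def)
  define lifts where "lifts x f \<longleftrightarrow> x \<in> carrier P \<and> f \<in> carrier P \<and> h (I +>\<^bsub>P\<^esub> x) = J +>\<^bsub>P\<^esub> f" for x f
  define \<phi> where "\<phi> f = \<tau> (SOME x. lifts x f)" for f
  have carrier: "carrier ?A = (\<lambda>x. I +>\<^bsub>P\<^esub> x) ` carrier P" "carrier ?B = (\<lambda>x. J +>\<^bsub>P\<^esub> x) ` carrier P"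
    by (auto simp: graded_quotient_def FactRing_def A_RCOSETS_def')
  have lift_ex: "\<exists>x. lifts x f" if "f \<in> carrier P" for f
  proof -
    have "J +>\<^bsub>P\<^esub> f \<in> h ` (\<lambda>x. I +>\<^bsub>P\<^esub> x) ` carrier P"
      using that h(2) by (simp add: carrier bij_betw_def)
    thus ?thesis using that by (auto simp: lifts_def)
  qed
  have \<phi>: "\<phi> f = \<tau> x" if x: "lifts x f" for x f
  proof -
    define y where "y = (SOME x. lifts x f)"
    have y: "lifts y f" unfolding y_def by (rule someI[of "\<lambda>x. lifts x f", OF x])
    have "inj_on h (carrier ?A)" using h(2) by (simp add: bij_betw_def)
    moreover have "h (I +>\<^bsub>P\<^esub> y) = h (I +>\<^bsub>P\<^esub> x)" using x y by (simp add: lifts_def)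
    moreover have "I +>\<^bsub>P\<^esub> y \<in> carrier ?A" "I +>\<^bsub>P\<^esub> x \<in> carrier ?A"
      using x y by (auto simp: lifts_def carrier)
    ultimately have "I +>\<^bsub>P\<^esub> y = I +>\<^bsub>P\<^esub> x" by (rule inj_onD)
    moreover have "x \<in> carrier P" "y \<in> carrier P" using x y by (auto simp: lifts_def)
    ultimately have "\<tau> y = \<tau> x" by (intro symmetric_trace_cong[OF I \<tau>])
    thus ?thesis by (simp add: \<phi>_def y_def)
  qed
  have lifts_add: "lifts (x \<oplus>\<^bsub>P\<^esub> y) (f \<oplus>\<^bsub>P\<^esub> g)" if "lifts x f" "lifts y g" for x y f g
  proof -
    have xy: "x \<in> carrier P" "y \<in> carrier P" and fg: "f \<in> carrier P" "g \<in> carrier P"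
      and hx: "h (I +>\<^bsub>P\<^esub> x) = J +>\<^bsub>P\<^esub> f" "h (I +>\<^bsub>P\<^esub> y) = J +>\<^bsub>P\<^esub> g"
      using that by (auto simp: lifts_def)
    have "h (I +>\<^bsub>P\<^esub> (x \<oplus>\<^bsub>P\<^esub> y)) = h ((I +>\<^bsub>P\<^esub> x) \<oplus>\<^bsub>?A\<^esub> (I +>\<^bsub>P\<^esub> y))"
      using ring_hom_add[OF I.rcos_ring_hom xy] by (simp add: graded_quotient_def)
    also have "\<dots> = h (I +>\<^bsub>P\<^esub> x) \<oplus>\<^bsub>?B\<^esub> h (I +>\<^bsub>P\<^esub> y)"
      using xy by (intro ring_hom_add[OF h(1)]) (auto simp: carrier)
    also have "\<dots> = J +>\<^bsub>P\<^esub> (f \<oplus>\<^bsub>P\<^esub> g)"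
      using ring_hom_add[OF J.rcos_ring_hom fg] hx by (simp add: graded_quotient_def)
    finally show ?thesis using xy fg by (simp add: lifts_def)
  qed
  have lifts_mult: "lifts (x \<otimes>\<^bsub>P\<^esub> y) (f \<otimes>\<^bsub>P\<^esub> g)" if "lifts x f" "lifts y g" for x y f g
  proof -
    have xy: "x \<in> carrier P" "y \<in> carrier P" and fg: "f \<in> carrier P" "g \<in> carrier P"
      and hx: "h (I +>\<^bsub>P\<^esub> x) = J +>\<^bsub>P\<^esub> f" "h (I +>\<^bsub>P\<^esub> y) = J +>\<^bsub>P\<^esub> g"
      using that by (auto simp: lifts_def)
    have "h (I +>\<^bsub>P\<^esub> (x \<otimes>\<^bsub>P\<^esub> y)) = h ((I +>\<^bsub>P\<^esub> x) \<otimes>\<^bsub>?A\<^esub> (I +>\<^bsub>P\<^esub> y))"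
      using ring_hom_mult[OF I.rcos_ring_hom xy] by (simp add: graded_quotient_def)
    also have "\<dots> = h (I +>\<^bsub>P\<^esub> x) \<otimes>\<^bsub>?B\<^esub> h (I +>\<^bsub>P\<^esub> y)"
      using xy by (intro ring_hom_mult[OF h(1)]) (auto simp: carrier)
    also have "\<dots> = J +>\<^bsub>P\<^esub> (f \<otimes>\<^bsub>P\<^esub> g)"
      using ring_hom_mult[OF J.rcos_ring_hom fg] hx by (simp add: graded_quotient_def)
    finally show ?thesis using xy fg by (simp add: lifts_def)
  qed
  have grade_eq: "(\<lambda>x. h (I +>\<^bsub>P\<^esub> x)) ` grade P n = (\<lambda>x. J +>\<^bsub>P\<^esub> x) ` grade P n" for n
    using h(3)[of n] by (simp add: graded_quotient_def image_image)
  have lift_grade: "\<exists>x\<in>grade P n. lifts x f" if f: "f \<in> grade P n" for f n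
  proof -
    have "J +>\<^bsub>P\<^esub> f \<in> (\<lambda>x. h (I +>\<^bsub>P\<^esub> x)) ` grade P n" unfolding grade_eq using f by simp
    then obtain x where "x \<in> grade P n" "J +>\<^bsub>P\<^esub> f = h (I +>\<^bsub>P\<^esub> x)" by blast
    thus ?thesis using grade[of n] f by (auto simp: lifts_def)
  qed
  have drop_grade: "\<exists>f\<in>grade P n. lifts x f" if x: "x \<in> grade P n" for x n
  proof -
    have "h (I +>\<^bsub>P\<^esub> x) \<in> (\<lambda>x. J +>\<^bsub>P\<^esub> x) ` grade P n" unfolding grade_eq[symmetric] using x by simp
    then obtain f where "f \<in> grade P n" "h (I +>\<^bsub>P\<^esub> x) = J +>\<^bsub>P\<^esub> f" by blast
    thus ?thesis using grade[of n] x by (auto simp: lifts_def)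
  qed
  have \<phi>_add: "\<phi> (f \<oplus>\<^bsub>P\<^esub> g) = \<phi> f + \<phi> g" if fg: "f \<in> carrier P" "g \<in> carrier P" for f g
  proof -
    obtain x y where xy: "lifts x f" "lifts y g" using lift_ex fg by blast
    have "\<phi> (f \<oplus>\<^bsub>P\<^esub> g) = \<tau> (x \<oplus>\<^bsub>P\<^esub> y)" by (rule \<phi>[OF lifts_add[OF xy]])
    also have "\<dots> = \<tau> x + \<tau> y"
      using \<tau> xy unfolding symmetric_trace_def lifts_def by blast
    finally show ?thesis using \<phi>[OF xy(1)] \<phi>[OF xy(2)] by simp
  qed
  have "symmetric_trace P J \<phi>"
    unfolding symmetric_trace_def
  proof (intro conjI ballI)
    fix f g assume "f \<in> carrier P" "g \<in> carrier P"
    thus "\<phi> (f \<oplus>\<^bsub>P\<^esub> g) = \<phi> f + \<phi> g" by (rule \<phi>_add)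
  next
    fix f assume f: "f \<in> J"
    have "J +>\<^bsub>P\<^esub> f = J +>\<^bsub>P\<^esub> \<zero>\<^bsub>P\<^esub>" using f by (simp add: J.a_rcos_const)
    moreover obtain x where x: "lifts x f" using lift_ex J.a_Hcarr[OF f] by blast
    ultimately have "lifts x \<zero>\<^bsub>P\<^esub>" by (simp add: lifts_def)
    hence "\<phi> f = \<phi> \<zero>\<^bsub>P\<^esub>" using \<phi>[OF x] \<phi>[of x "\<zero>\<^bsub>P\<^esub>"] by simp
    also have "\<phi> \<zero>\<^bsub>P\<^esub> = 0" using \<phi>_add[of "\<zero>\<^bsub>P\<^esub>" "\<zero>\<^bsub>P\<^esub>"] by simp
    finally show "\<phi> f = 0" .
  next
    fix f g assume "f \<in> grade P 1" "g \<in> grade P 1"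
    then obtain x y where xy: "x \<in> grade P 1" "y \<in> grade P 1" "lifts x f" "lifts y g"
      using lift_grade by metis
    have "\<phi> (f \<otimes>\<^bsub>P\<^esub> g) = \<tau> (x \<otimes>\<^bsub>P\<^esub> y)" by (intro \<phi> lifts_mult xy)
    also have "\<dots> = \<tau> (y \<otimes>\<^bsub>P\<^esub> x)" using \<tau> xy by (simp add: symmetric_trace_def)
    also have "\<dots> = \<phi> (g \<otimes>\<^bsub>P\<^esub> f)" by (intro \<phi>[symmetric] lifts_mult xy)
    finally show "\<phi> (f \<otimes>\<^bsub>P\<^esub> g) = \<phi> (g \<otimes>\<^bsub>P\<^esub> f)" .
  qed
  moreover have "\<phi> ` grade P n = \<tau> ` grade P n" for n
  proof (intro equalityI subsetI)
    fix t assume "t \<in> \<phi> ` grade P n"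
    then obtain f where f: "f \<in> grade P n" "t = \<phi> f" by blast
    then obtain x where "x \<in> grade P n" "lifts x f" using lift_grade by blast
    thus "t \<in> \<tau> ` grade P n" using f \<phi> by blast
  next
    fix t assume "t \<in> \<tau> ` grade P n"
    then obtain x where x: "x \<in> grade P n" "t = \<tau> x" by blast
    then obtain f where "f \<in> grade P n" "lifts x f" using drop_grade by blast
    thus "t \<in> \<phi> ` grade P n" using x \<phi>[of x f] by (intro image_eqI[of _ _ f]) simp_all
  qed
  ultimately show ?thesis by (rule that)
qed

section \<open>The trace of the zigzag algebra\<close>

definition loop_trace :: "'v set \<Rightarrow> ('v list \<Rightarrow> 'k::field) \<Rightarrow> 'k" where
  "loop_trace V f = (\<Sum>a\<in>V. \<Sum>b\<in>V. f [a, b, a])"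

lemma loop_trace_commute:
  assumes "x \<in> grade (path_algebra V E) 1" "y \<in> grade (path_algebra V E) 1"
  shows "loop_trace V (x \<otimes>\<^bsub>path_algebra V E\<^esub> y) = loop_trace V (y \<otimes>\<^bsub>path_algebra V E\<^esub> x)"
proof -
  have xy: "x \<in> carrier (path_algebra V E)" "y \<in> carrier (path_algebra V E)"
    "\<And>a. x [a] = 0" "\<And>a. y [a] = 0"
    using assms by (force simp: path_algebra_grade)+
  show ?thesis unfolding loop_trace_def
    by (subst sum.swap) (simp add: xy path_algebra_mult_splits mult.commute)
qed

text \<open>The vanishing of the sum is required at each vertex separately: left multiplication rescales the
  coefficients of the paths \<open>(a | b | a)\<close> by a factor that depends on \<open>a\<close>, so the kernel of the
  loop trace itself is not an ideal. The coefficients in degrees zero and one must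
  vanish as well, since products could move them to degree two.\<close>

definition loop_kernel :: "'v set \<Rightarrow> 'v set set \<Rightarrow> ('v list \<Rightarrow> 'k::field) set" where
  "loop_kernel V E = {f \<in> carrier (path_algebra V E).
     (\<forall>a. f [a] = 0) \<and> (\<forall>a b. f [a, b] = 0) \<and> (\<forall>a. (\<Sum>b\<in>V. f [a, b, a]) = 0)}"

lemma ideal_loop_kernel:
  assumes "finite V"
  shows "ideal (loop_kernel V E) (path_algebra V E :: ('k::field, 'v list \<Rightarrow> 'k) graded_algebra)"
    (is "ideal _ ?P")
proof -
  interpret ring ?P by (rule ring_path_algebra[OF assms])
  have neg: "\<ominus>\<^bsub>?P\<^esub> f = (\<lambda>p. - f p)" if "f \<in> carrier ?P" for f
    by (rule minus_equality) (auto simp: that path_algebra_neg_closed)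
  show ?thesis
  proof (rule idealI)
    show "ring ?P" by (rule ring_axioms)
    show "subgroup (loop_kernel V E) (add_monoid ?P)"
      by (rule subgroup.intro)
         (auto simp: loop_kernel_def sum.distrib neg sum_negf path_algebra_neg_closed
               simp flip: a_inv_def)
  qed (auto simp: loop_kernel_def path_algebra_mult_splits simp flip: sum_distrib_left sum_distrib_right)
qed

lemma zigzag_ideal_loop_kernel:
  assumes G: "simple_graph V E"
  shows "genideal (path_algebra V E) (zigzag_relations E :: ('v list \<Rightarrow> 'k::field) set)
         \<subseteq> loop_kernel V E"
proof -
  have fin: "finite V" using G by (simp add: simple_graph_def)
  interpret ring "path_algebra V E :: ('k, 'v list \<Rightarrow> 'k) graded_algebra"
    by (rule ring_path_algebra[OF fin])
  have "(zigzag_relations E :: ('v list \<Rightarrow> 'k) set) \<subseteq> loop_kernel V E"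
  proof
    fix f :: "'v list \<Rightarrow> 'k" assume f: "f \<in> zigzag_relations E"
    hence c: "f \<in> carrier (path_algebra V E)" using zigzag_relations_closed[OF G] by blast
    from f consider (1) a b c where "f = basis_path [a, b, c]" "a \<noteq> c"
      | (2) a b c where "f = (\<lambda>p. basis_path [a, b, a] p - basis_path [a, c, a] p)"
          "{a, b} \<in> E" "{a, c} \<in> E"
      unfolding zigzag_relations_def by blast
    thus "f \<in> loop_kernel V E"
    proof cases
      case 1
      thus ?thesis using c by (auto simp: loop_kernel_def basis_path_def intro!: sum.neutral)
    next
      case 2
      have bc: "b \<in> V" "c \<in> V" using edge_paths[OF G 2(2)] edge_paths[OF G 2(3)] by auto
      have "(\<Sum>y\<in>V. f [x, y, x]) = 0" for x
      proof (cases "x = a")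
        case True
        thus ?thesis using bc fin unfolding 2 by (simp add: basis_path_def sum_subtractf)
      next
        case False
        thus ?thesis unfolding 2 by (simp add: basis_path_def)
      qed
      moreover have "f [x] = 0" "f [x, y] = 0" for x y unfolding 2 by (auto simp: basis_path_def)
      ultimately show ?thesis using c by (auto simp: loop_kernel_def)
    qed
  qed
  thus ?thesis by (rule genideal_minimal[OF ideal_loop_kernel[OF fin]])
qed

lemma loop_trace_symmetric:
  assumes G: "simple_graph V E"
  shows "symmetric_trace (path_algebra V E :: ('k::field, 'v list \<Rightarrow> 'k) graded_algebra)
           (genideal (path_algebra V E) (zigzag_relations E)) (loop_trace V)"
  unfolding symmetric_trace_def
proof (intro conjI ballI)
  fix f :: "'v list \<Rightarrow> 'k" assume "f \<in> genideal (path_algebra V E) (zigzag_relations E)"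
  hence "f \<in> loop_kernel V E" using zigzag_ideal_loop_kernel[OF G] by blast
  thus "loop_trace V f = 0" by (simp add: loop_trace_def loop_kernel_def)
qed (auto simp: loop_trace_def sum.distrib intro: loop_trace_commute[unfolded loop_trace_def])

section \<open>Traces of the algebra with orientation coefficients\<close>

text \<open>Along a path the value of \<open>s\<close> changes only its sign, so the values \<open>s a\<close> and \<open>- s a\<close> exhaust
  the vertices of a connected graph and serve as the two colours.\<close>

lemma sign_alternating_bipartite:
  fixes s :: "'v \<Rightarrow> 'k::field"
  assumes char: "CHAR('k) \<noteq> 2" and G: "simple_graph V E" and conn: "connected_graph V E"
    and alt: "\<And>a b. {a, b} \<in> E \<Longrightarrow> s b = - s a"
    and a: "a \<in> V" "s a \<noteq> 0"
  shows "bipartite V E"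
proof -
  have "(2::'k) \<noteq> 0"
  proof
    assume "(2::'k) = 0"
    hence "of_nat 2 = (0::'k)" by simp
    hence "CHAR('k) dvd 2" by (simp only: of_nat_eq_0_iff_char_dvd)
    moreover from this have "CHAR('k) \<noteq> 0" by (intro notI) simp
    moreover from calculation(1) have "CHAR('k) \<le> 2" by (rule dvd_imp_le) simp
    moreover have "CHAR('k) \<noteq> 1" by simp
    ultimately show False using char by linarith
  qed
  hence ne: "s a \<noteq> - s a"
  proof (intro notI)
    assume "s a = - s a"
    hence "2 * s a = 0" unfolding mult_2 by (metis add.right_inverse)
    with \<open>(2::'k) \<noteq> 0\<close> a(2) show False by simp
  qed
  have along: "s (last p) = s (hd p) \<or> s (last p) = - s (hd p)"
    if "p \<noteq> []" "successively (\<lambda>a b. {a, b} \<in> E) p" for p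
    using that
  proof (induction p rule: induct_list012)
    case (3 x y zs)
    thus ?case using alt[of x y] by auto
  qed auto
  have two_values: "s v = s a \<or> s v = - s a" if "v \<in> V" for v
  proof -
    obtain p where "p \<in> paths V E" "hd p = a" "last p = v"
      using conn a(1) \<open>v \<in> V\<close> unfolding connected_graph_def by blast
    thus ?thesis using along[of p] by (simp add: paths_def)
  qed
  let ?X = "{v \<in> V. s v = s a}" and ?Y = "{v \<in> V. s v = - s a}"
  show ?thesis unfolding bipartite_def
  proof (intro exI conjI ballI)
    show "?X \<union> ?Y = V" using two_values by auto
    show "?X \<inter> ?Y = {}" using ne by auto
    fix e assume e: "e \<in> E"
    then obtain x y where xy: "e = {x, y}" "x \<in> V" "y \<in> V"
      using G by (auto simp: simple_graph_def card_2_iff)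
    have y: "s y = - s x" using alt[of x y] e xy(1) by simp
    from two_values[OF xy(2)] show "\<exists>x\<in>?X. \<exists>y\<in>?Y. e = {x, y}"
    proof
      assume "s x = s a"
      thus ?thesis using y xy by (intro bexI[of _ x] bexI[of _ y]) auto
    next
      assume "s x = - s a"
      thus ?thesis using y xy by (intro bexI[of _ y] bexI[of _ x]) auto
    qed
  qed
qed

text \<open>A symmetric trace would give a function on the vertices that changes sign along every edge; on a
  connected graph that is not bipartite, such a function is zero.\<close>

lemma symmetric_trace_skew_zero:
  fixes \<epsilon> :: "'v \<Rightarrow> 'v \<Rightarrow> 'k::field"
  assumes char: "CHAR('k) \<noteq> 2" and G: "simple_graph V E" and conn: "connected_graph V E"
    and nonbip: "\<not> bipartite V E" and eps: "orientation_coefficients V E \<epsilon>"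
    and \<phi>: "symmetric_trace (path_algebra V E)
               (genideal (path_algebra V E) (skew_zigzag_relations E \<epsilon>)) \<phi>"
    and f: "f \<in> grade (path_algebra V E) 2"
  shows "\<phi> f = (0::'k)"
proof -
  let ?P = "path_algebra V E :: ('k, 'v list \<Rightarrow> 'k) graded_algebra"
  let ?I = "genideal ?P (skew_zigzag_relations E \<epsilon>)"
  have fin: "finite V" using G by (simp add: simple_graph_def)
  interpret ring ?P by (rule ring_path_algebra[OF fin])
  interpret I: ideal ?I ?P by (rule genideal_ideal[OF skew_zigzag_relations_closed[OF G]])
  have rel: "skew_zigzag_relations E \<epsilon> \<subseteq> ?I"
    by (rule genideal_self[OF skew_zigzag_relations_closed[OF G]])
  have kill: "\<phi> g = 0" if "g \<in> ?I" for g using \<phi> that by (simp add: symmetric_trace_def)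
  have add: "\<phi> (f \<oplus>\<^bsub>?P\<^esub> g) = \<phi> f + \<phi> g" if "f \<in> carrier ?P" "g \<in> carrier ?P" for f g
    using \<phi> that by (simp add: symmetric_trace_def)
  have scale: "(\<lambda>p. c * g p) \<in> ?I" if g: "g \<in> ?I" for c g
  proof -
    \<comment> \<open>A scalar multiple is the product with a multiple of the identity.\<close>
    let ?c = "\<lambda>p. c * \<one>\<^bsub>?P\<^esub> p"
    have c: "?c \<in> carrier ?P"
      using one_closed by (auto simp: path_algebra_carrier intro: finite_subset[rotated])
    have "?c \<otimes>\<^bsub>?P\<^esub> g = (\<lambda>p. c * (\<one>\<^bsub>?P\<^esub> \<otimes>\<^bsub>?P\<^esub> g) p)"
      using path_algebra_mult_splits[OF c I.a_Hcarr[OF g]]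
        path_algebra_mult_splits[OF one_closed I.a_Hcarr[OF g]]
      by (auto simp: sum_distrib_left mult.assoc simp del: l_one)
    thus ?thesis using I.I_l_closed[OF g c] I.a_Hcarr[OF g] by simp
  qed
  have bent: "\<phi> (monomial c [a, b, d]) = 0" if "{a, b} \<in> E" "{b, d} \<in> E" "a \<noteq> d" for a b c d
  proof -
    have "basis_path [a, b, d] \<in> skew_zigzag_relations E \<epsilon>"
      unfolding skew_zigzag_relations_def using that by blast
    hence "(\<lambda>p. c * basis_path [a, b, d] p) \<in> ?I" using scale rel by blast
    moreover have "(\<lambda>p. c * basis_path [a, b, d] p) = monomial c [a, b, d]"
      by (auto simp: basis_path_def monomial_def)
    ultimately show ?thesis using kill by simp
  qed
  have independent: "\<phi> (monomial (c * \<epsilon> a b) [a, b, a]) = \<phi> (monomial (c * \<epsilon> a d) [a, d, a])"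
    if "{a, b} \<in> E" "{a, d} \<in> E" for a b c d
  proof -
    let ?r = "\<lambda>p. c * (\<epsilon> a b * basis_path [a, b, a] p - \<epsilon> a d * basis_path [a, d, a] p)"
    have "(\<lambda>p. \<epsilon> a b * basis_path [a, b, a] p - \<epsilon> a d * basis_path [a, d, a] p)
            \<in> skew_zigzag_relations E \<epsilon>"
      unfolding skew_zigzag_relations_def using that by blast
    hence r: "?r \<in> ?I" using scale rel by blast
    have "monomial (c * \<epsilon> a b) [a, b, a] = ?r \<oplus>\<^bsub>?P\<^esub> monomial (c * \<epsilon> a d) [a, d, a]"
      by (auto simp: basis_path_def monomial_def algebra_simps)
    moreover have "monomial (c * \<epsilon> a d) [a, d, a] \<in> carrier ?P"
      using edge_paths[OF G that(2)] by (simp add: monomial_closed)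
    ultimately show ?thesis using add[OF I.a_Hcarr[OF r]] kill[OF r] by simp
  qed
  have swap: "\<phi> (monomial c [a, b, a]) = \<phi> (monomial c [b, a, b])" if "{a, b} \<in> E" for a b c
  proof -
    note p = edge_paths[OF G that]
    have "monomial c [a, b, a] = monomial c [a, b] \<otimes>\<^bsub>?P\<^esub> monomial 1 [b, a]"
      "monomial c [b, a, b] = monomial 1 [b, a] \<otimes>\<^bsub>?P\<^esub> monomial c [a, b]"
      using p by (simp_all add: monomial_mult)
    thus ?thesis using \<phi> p by (simp add: symmetric_trace_def monomial_grade)
  qed
  have neg: "\<phi> (monomial (- c) p) = - \<phi> (monomial c p)" if "p \<in> paths V E" for c p
  proof -
    have "monomial (- c) p \<oplus>\<^bsub>?P\<^esub> monomial c p = \<zero>\<^bsub>?P\<^esub>" by (auto simp: monomial_def)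
    moreover have "\<phi> \<zero>\<^bsub>?P\<^esub> = 0" by (rule kill) (rule I.zero_closed)
    ultimately show ?thesis using add[of "monomial (- c) p" "monomial c p"] that
      by (simp add: monomial_closed eq_neg_iff_add_eq_0)
  qed
  have loop: "\<phi> (monomial c [a, b, a]) = 0" if ab: "{a, b} \<in> E" for a b c
  proof (rule ccontr)
    assume nz: "\<phi> (monomial c [a, b, a]) \<noteq> 0"
    have e: "\<epsilon> x y \<noteq> 0" "\<epsilon> y x = - \<epsilon> x y" if "{x, y} \<in> E" for x y
      using eps edge_paths[OF G that] that
      by (force simp: orientation_coefficients_def)+
    \<comment> \<open>The scalar is chosen so that \<open>s a\<close> below is \<open>\<phi> (c (a | b | a))\<close>.\<close>
    define d where "d = c / \<epsilon> a b"
    \<comment> \<open>An arbitrary neighbour; at an isolated vertex no edge constrains the value of \<open>s\<close>.\<close>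
    define n where "n x = (SOME y. {x, y} \<in> E)" for x
    define s where "s x = \<phi> (monomial (d * \<epsilon> x (n x)) [x, n x, x])" for x
    have s: "s x = \<phi> (monomial (d * \<epsilon> x y) [x, y, x])" if "{x, y} \<in> E" for x y
      using independent[of x "n x" y d] that someI[of "\<lambda>y. {x, y} \<in> E" y]
      by (simp add: s_def n_def)
    have "s y = - s x" if xy: "{x, y} \<in> E" for x y
    proof -
      have yx: "{y, x} \<in> E" using xy by (simp add: insert_commute)
      have "s y = \<phi> (monomial (- (d * \<epsilon> x y)) [y, x, y])" using s[OF yx] e(2)[OF xy] by simp
      also have "\<dots> = - \<phi> (monomial (d * \<epsilon> x y) [y, x, y])"
        using edge_paths[OF G yx] by (intro neg)
      also have "\<dots> = - s x" using s[OF xy] swap[OF xy] by simp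
      finally show ?thesis .
    qed
    moreover have "s a \<noteq> 0" using s[OF ab] nz e(1)[OF ab] by (simp add: d_def)
    ultimately show False
      using sign_alternating_bipartite[OF char G conn] nonbip edge_paths(1)[OF G ab] by blast
  qed
  \<comment> \<open>By additivity only multiples of single paths matter: closed ones, or relations.\<close>
  from f show ?thesis
  proof (induction rule: grade_induct)
    case zero
    show ?case by (rule kill) (rule I.zero_closed)
  next
    case (plus c p f)
    obtain x y z where p: "p = [x, y, z]"
      using plus(2) by (auto simp: length_Suc_conv numeral_2_eq_2)
    have xyz: "{x, y} \<in> E" "{y, z} \<in> E" using plus(1) by (auto simp: p paths_def)
    have "\<phi> (monomial c p) = 0"
      using loop[OF xyz(1)] bent[OF xyz] unfolding p by (cases "x = z") auto
    thus ?case using plus add[OF monomial_closed[OF plus(1)], of f c]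
      by (simp add: path_algebra_grade del: path_algebra_add)
  qed
qed

theorem proposition5p3:
  fixes V :: "'v set" and E :: "'v set set" and \<epsilon> :: "'v \<Rightarrow> 'v \<Rightarrow> 'k::field"
  assumes "CHAR('k) \<noteq> 2"
    and "simple_graph V E"
    and "connected_graph V E"
    and "\<not> bipartite V E"
    and "orientation_coefficients V E \<epsilon>"
  shows "\<not> isomorphic_graded_algebras
           (zigzag_algebra V E :: ('k, ('v list \<Rightarrow> 'k) set) graded_algebra)
           (skew_zigzag_algebra V E \<epsilon>)"
proof
  let ?P = "path_algebra V E :: ('k, 'v list \<Rightarrow> 'k) graded_algebra"
  let ?I = "genideal ?P (zigzag_relations E)"
  let ?J = "genideal ?P (skew_zigzag_relations E \<epsilon>)"
  assume iso: "isomorphic_graded_algebras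
           (zigzag_algebra V E :: ('k, ('v list \<Rightarrow> 'k) set) graded_algebra)
           (skew_zigzag_algebra V E \<epsilon>)"
  note G = assms(2)
  have fin: "finite V" using G by (simp add: simple_graph_def)
  interpret ring ?P by (rule ring_path_algebra[OF fin])
  obtain \<phi> where \<phi>: "symmetric_trace ?P ?J \<phi>" "\<And>n. \<phi> ` grade ?P n = loop_trace V ` grade ?P n"
  proof (rule isomorphic_quotients_symmetric_trace)
    show "ideal ?I ?P" by (rule genideal_ideal[OF zigzag_relations_closed[OF G]])
    show "ideal ?J ?P" by (rule genideal_ideal[OF skew_zigzag_relations_closed[OF G]])
    show "isomorphic_graded_algebras (graded_quotient ?P ?I) (graded_quotient ?P ?J)"
      using iso by (simp add: zigzag_algebra_def skew_zigzag_algebra_def)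
    show "symmetric_trace ?P ?I (loop_trace V)" by (rule loop_trace_symmetric[OF G])
  qed (auto simp: path_algebra_grade)
  have "E \<noteq> {}"
  proof
    assume "E = {}"
    hence "bipartite V E" by (auto simp: bipartite_def)
    with assms(4) show False by simp
  qed
  then obtain a b where ab: "{a, b} \<in> E"
    using G by (auto simp: simple_graph_def card_2_iff) metis
  \<comment> \<open>Any edge gives a closed path on which the zigzag trace is one.\<close>
  note p = edge_paths[OF G ab]
  have "loop_trace V (monomial 1 [a, b, a]) = (\<Sum>x\<in>V. \<Sum>y\<in>V. if x = a \<and> y = b then 1 else (0::'k))"
    unfolding loop_trace_def monomial_def by (intro sum.cong) auto
  also have "\<dots> = (\<Sum>x\<in>V. if x = a then 1 else 0)"
    using fin p by (intro sum.cong) auto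
  also have "\<dots> = 1" using fin p by simp
  finally have "loop_trace V (monomial 1 [a, b, a]) = (1::'k)" .
  moreover have "monomial 1 [a, b, a] \<in> grade ?P 2" using p by (intro monomial_grade) auto
  ultimately have "1 \<in> \<phi> ` grade ?P 2" unfolding \<phi>(2) by (metis image_eqI)
  moreover have "\<phi> f = 0" if "f \<in> grade ?P 2" for f
    by (rule symmetric_trace_skew_zero[OF assms \<phi>(1) that])
  ultimately show False by auto
qed

end
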